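(* The map-germ $f:(\mathbb{R}^4,0)\to(\mathbb{R}^2,0)$ defined by $f(r,s,x,y)=(r\cos s+x^2-y^2,\ r\sin s+2xy)$ has infinite $\mathcal{A}_e$-codimension.
   Context: Standard notation of singularity theory: $\mathcal{E}_n$ is the ring of smooth function-germs $(\mathbb{R}^n,0)\to\mathbb{R}$, and $\mathcal{E}_n^p$ is the module of $p$-tuples. For a smooth map-germ $f:(\mathbb{R}^n,0)\to(\mathbb{R}^p,0)$, $tf:\mathcal{E}_n^n\to\mathcal{E}_n^p$ is $tf(\xi)=df(\xi)$ and $\omega f:\mathcal{E}_p^p\to\mathcal{E}_n^p$ is $\omega f(\eta)=\eta\circ f$. The extended tangent space is $T\mathcal{A}_ef=tf(\mathcal{E}_n^n)+\omega f(\mathcal{E}_p^p)$, and the $\mathcal{A}_e$-codimension of $f$ is $\dim_{\mathbb{R}}\mathcal{E}_n^p/T\mathcal{A}_ef$. *)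

theory Defs
  imports "HOL-Analysis.Analysis" "HOL-Library.Extended_Nat"
begin

section \<open>Smooth maps\<close>

text \<open>
  Intended for open \<open>U\<close>. The domain is finite-dimensional, so continuity of all iterated
  directional derivatives is the usual notion of \<open>C\<^sup>k\<close>.
\<close>

fun Ck_on :: "nat \<Rightarrow> ('a::euclidean_space \<Rightarrow> 'b::real_normed_vector) \<Rightarrow> 'a set \<Rightarrow> bool" where
  "Ck_on 0 f U \<longleftrightarrow> continuous_on U f"
| "Ck_on (Suc k) f U \<longleftrightarrow>
     (\<forall>x\<in>U. f differentiable at x) \<and>
     (\<forall>v. Ck_on k (\<lambda>x. frechet_derivative f (at x) v) U)"

definition smooth_on :: "('a::euclidean_space \<Rightarrow> 'b::real_normed_vector) \<Rightarrow> 'a set \<Rightarrow> bool" where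
  "smooth_on f U \<longleftrightarrow> (\<forall>k. Ck_on k f U)"

definition smooth_at_0 :: "('a::euclidean_space \<Rightarrow> 'b::real_normed_vector) \<Rightarrow> bool" where
  "smooth_at_0 f \<longleftrightarrow> (\<exists>U. open U \<and> 0 \<in> U \<and> smooth_on f U)"

lemma Ck_on_cong:
  assumes "open U" "\<And>x. x \<in> U \<Longrightarrow> f x = g x"
  shows "Ck_on k f U \<longleftrightarrow> Ck_on k g U"
  using assms
proof (induction k arbitrary: f g)
  case 0
  then show ?case using continuous_on_cong by (metis Ck_on.simps(1))
next
  case (Suc k)
  have D: "(f has_derivative D) (at x) \<longleftrightarrow> (g has_derivative D) (at x)" if "x \<in> U" for x D
    using Suc.prems that
    by (metis has_derivative_transform_within_open)
  have "f differentiable at x \<longleftrightarrow> g differentiable at x" if "x \<in> U" for x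
    using D[OF that] by (simp add: differentiable_def)
  moreover have "frechet_derivative f (at x) = frechet_derivative g (at x)" if "x \<in> U" for x
    using D[OF that] by (simp add: frechet_derivative_def)
  ultimately show ?case
    using Suc.IH[of "\<lambda>x. frechet_derivative f (at x) v" "\<lambda>x. frechet_derivative g (at x) v" for v] Suc.prems(1)
    by simp
qed

lemma Ck_on_subset: "Ck_on k f U \<Longrightarrow> V \<subseteq> U \<Longrightarrow> Ck_on k f V"
  by (induction k arbitrary: f) (auto intro: continuous_on_subset)

lemma Ck_on_SucD: "Ck_on (Suc k) f U \<Longrightarrow> Ck_on k f U"
proof (induction k arbitrary: f)
  case 0
  then show ?case
    by (auto intro!: continuous_at_imp_continuous_on differentiable_imp_continuous_within)
next
  case (Suc k)
  then show ?case by (metis Ck_on.simps(2))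
qed

lemma Ck_on_SucI:
  assumes "open U" "\<And>x. x \<in> U \<Longrightarrow> (f has_derivative D x) (at x)"
    and "\<And>v. Ck_on k (\<lambda>x. D x v) U"
  shows "Ck_on (Suc k) f U"
proof -
  have "frechet_derivative f (at x) = D x" if "x \<in> U" for x
    using assms(2)[OF that] by (metis frechet_derivative_at)
  then have "Ck_on k (\<lambda>x. frechet_derivative f (at x) v) U" for v
    using assms(3)[of v] Ck_on_cong[OF assms(1), of "\<lambda>x. frechet_derivative f (at x) v" "\<lambda>x. D x v" k] by simp
  then show ?thesis using assms(2) by (auto simp: differentiable_def)
qed

lemma Ck_on_has_derivative:
  "Ck_on (Suc k) f U \<Longrightarrow> x \<in> U \<Longrightarrow> (f has_derivative frechet_derivative f (at x)) (at x)"
  by (simp add: frechet_derivative_works)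

lemma Ck_on_const: "open U \<Longrightarrow> Ck_on k (\<lambda>x. c) U"
  by (induction k arbitrary: c) (auto intro!: Ck_on_SucI[where D = "\<lambda>_ _. 0"] simp del: Ck_on.simps(2))

lemma Ck_on_bounded_linear:
  assumes L: "bounded_linear L" and "open U"
  shows "Ck_on k f U \<Longrightarrow> Ck_on k (\<lambda>x. L (f x)) U"
proof (induction k arbitrary: f)
  case 0
  then show ?case using L by (simp add: bounded_linear.continuous_on)
next
  case (Suc k)
  show ?case
    using Suc bounded_linear.has_derivative[OF L Ck_on_has_derivative[OF Suc.prems]]
    by (intro Ck_on_SucI[OF \<open>open U\<close>]) auto
qed

lemma Ck_on_add:
  assumes "open U"
  shows "Ck_on k f U \<Longrightarrow> Ck_on k g U \<Longrightarrow> Ck_on k (\<lambda>x. f x + g x) U"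
proof (induction k arbitrary: f g)
  case 0
  then show ?case by (simp add: continuous_on_add)
next
  case (Suc k)
  show ?case
    using Suc has_derivative_add[OF Ck_on_has_derivative[OF Suc.prems(1)] Ck_on_has_derivative[OF Suc.prems(2)]]
    by (intro Ck_on_SucI[OF \<open>open U\<close>]) auto
qed

lemma Ck_on_sum:
  assumes "open U" "\<And>i. i \<in> I \<Longrightarrow> Ck_on k (f i) U"
  shows "Ck_on k (\<lambda>x. \<Sum>i\<in>I. f i x) U"
  using assms(2)
  by (induction I rule: infinite_finite_induct)
     (auto intro: Ck_on_add Ck_on_const \<open>open U\<close>)

lemma Ck_on_bilinear:
  assumes B: "bounded_bilinear B" and "open U"
  shows "Ck_on k f U \<Longrightarrow> Ck_on k g U \<Longrightarrow> Ck_on k (\<lambda>x. B (f x) (g x)) U"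
proof (induction k arbitrary: f g)
  case 0
  then show ?case using B by (simp add: bounded_bilinear.continuous_on)
next
  case (Suc k)
  show ?case
  proof (rule Ck_on_SucI[OF \<open>open U\<close>])
    show "((\<lambda>x. B (f x) (g x)) has_derivative
      (\<lambda>v. B (f x) (frechet_derivative g (at x) v) + B (frechet_derivative f (at x) v) (g x))) (at x)"
      if "x \<in> U" for x
      using bounded_bilinear.FDERIV[OF B Ck_on_has_derivative[OF Suc.prems(1) that] Ck_on_has_derivative[OF Suc.prems(2) that]] .
    show "Ck_on k (\<lambda>x. B (f x) (frechet_derivative g (at x) v) + B (frechet_derivative f (at x) v) (g x)) U" for v
      using Suc Ck_on_SucD[OF Suc.prems(1)] Ck_on_SucD[OF Suc.prems(2)]
      by (intro Ck_on_add \<open>open U\<close> Suc.IH) auto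
  qed
qed

lemma has_derivative_expand_Basis:
  assumes "(g has_derivative D) F"
  shows "D v = (\<Sum>b\<in>Basis. (v \<bullet> b) *\<^sub>R D b)"
proof -
  interpret linear D using assms by (rule has_derivative_linear)
  have "D v = D (\<Sum>b\<in>Basis. (v \<bullet> b) *\<^sub>R b)" by (simp add: euclidean_representation)
  also have "\<dots> = (\<Sum>b\<in>Basis. (v \<bullet> b) *\<^sub>R D b)" by (simp add: sum scaleR)
  finally show ?thesis .
qed

lemma Ck_on_compose:
  fixes f :: "'a::euclidean_space \<Rightarrow> 'b::euclidean_space" and g :: "'b \<Rightarrow> 'c::real_normed_vector"
  assumes "open U" "open V" "f ` U \<subseteq> V"
  shows "Ck_on k f U \<Longrightarrow> Ck_on k g V \<Longrightarrow> Ck_on k (\<lambda>x. g (f x)) U"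
proof (induction k arbitrary: g)
  case 0
  then show ?case using assms continuous_on_compose2[of V g U f] by simp
next
  case (Suc k)
  let ?f = "\<lambda>x. frechet_derivative f (at x)" and ?g = "\<lambda>y. frechet_derivative g (at y)"
  show ?case
  proof (rule Ck_on_SucI[OF \<open>open U\<close>])
    fix x assume x: "x \<in> U"
    then have g: "(g has_derivative ?g (f x)) (at (f x))"
      using assms Suc.prems(2) by (intro Ck_on_has_derivative) auto
    have "?g (f x) \<circ> ?f x = (\<lambda>v. \<Sum>b\<in>Basis. (?f x v \<bullet> b) *\<^sub>R ?g (f x) b)"
      unfolding o_def by (rule ext) (rule has_derivative_expand_Basis[OF g])
    then show "((\<lambda>x. g (f x)) has_derivative (\<lambda>v. \<Sum>b\<in>Basis. (?f x v \<bullet> b) *\<^sub>R ?g (f x) b)) (at x)"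
      using diff_chain_at[OF Ck_on_has_derivative[OF Suc.prems(1) x] g] unfolding o_def by simp
  next
    fix v
    have "Ck_on k (\<lambda>x. ?g (f x) b) U" for b
      using Suc.prems(2) by (intro Suc.IH Ck_on_SucD[OF Suc.prems(1)]) auto
    moreover have "Ck_on k (\<lambda>x. ?f x v \<bullet> b) U" for b
      using Suc.prems(1) by (intro Ck_on_bounded_linear[OF bounded_linear_inner_left \<open>open U\<close>]) auto
    ultimately show "Ck_on k (\<lambda>x. \<Sum>b\<in>Basis. (?f x v \<bullet> b) *\<^sub>R ?g (f x) b) U"
      by (intro Ck_on_sum Ck_on_bilinear[OF bounded_bilinear_scaleR] \<open>open U\<close>)
  qed
qed

lemma Ck_on_derivative_apply:
  fixes f :: "'a::euclidean_space \<Rightarrow> 'b::real_normed_vector"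
  assumes "open U" "Ck_on (Suc k) f U" "Ck_on k \<xi> U"
  shows "Ck_on k (\<lambda>x. frechet_derivative f (at x) (\<xi> x)) U"
proof -
  have "Ck_on k (\<lambda>x. \<Sum>b\<in>Basis. (\<xi> x \<bullet> b) *\<^sub>R frechet_derivative f (at x) b) U"
    using assms
    by (intro Ck_on_sum Ck_on_bilinear[OF bounded_bilinear_scaleR]
        Ck_on_bounded_linear[OF bounded_linear_inner_left]) auto
  moreover have "frechet_derivative f (at x) (\<xi> x)
      = (\<Sum>b\<in>Basis. (\<xi> x \<bullet> b) *\<^sub>R frechet_derivative f (at x) b)" if "x \<in> U" for x
    using has_derivative_expand_Basis[OF Ck_on_has_derivative[OF assms(2) that]] .
  ultimately show ?thesis
    by (subst Ck_on_cong[OF assms(1), where g = "\<lambda>x. \<Sum>b\<in>Basis. (\<xi> x \<bullet> b) *\<^sub>R frechet_derivative f (at x) b"])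
qed

lemma smooth_on_subset: "smooth_on f U \<Longrightarrow> V \<subseteq> U \<Longrightarrow> smooth_on f V"
  by (simp only: smooth_on_def) (rule allI, rule Ck_on_subset, erule spec, assumption)

lemma smooth_at_0_const: "smooth_at_0 (\<lambda>x. c)"
  unfolding smooth_at_0_def smooth_on_def by (intro exI[of _ UNIV]) (simp add: Ck_on_const)

lemma smooth_at_0_linear:
  assumes "bounded_linear L" "smooth_at_0 f"
  shows "smooth_at_0 (\<lambda>x. L (f x))"
proof -
  obtain U where U: "open U" "0 \<in> U" "smooth_on f U"
    using assms(2) by (auto simp: smooth_at_0_def)
  have "Ck_on k (\<lambda>x. L (f x)) U" for k
    using U(3) unfolding smooth_on_def by (intro Ck_on_bounded_linear[OF assms(1) U(1)]) blast
  then show ?thesis using U unfolding smooth_at_0_def smooth_on_def by blast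
qed

lemma smooth_at_0_2E:
  assumes "smooth_at_0 f" "smooth_at_0 g"
  obtains U where "open U" "0 \<in> U" "smooth_on f U" "smooth_on g U"
proof -
  obtain U V where "open U" "0 \<in> U" "smooth_on f U" "open V" "0 \<in> V" "smooth_on g V"
    using assms by (auto simp: smooth_at_0_def)
  then show ?thesis
    using smooth_on_subset[of f U "U \<inter> V"] smooth_on_subset[of g V "U \<inter> V"]
    by (intro that[of "U \<inter> V"]) (simp_all add: open_Int)
qed

lemma smooth_at_0_add:
  assumes "smooth_at_0 f" "smooth_at_0 g"
  shows "smooth_at_0 (\<lambda>x. f x + g x)"
proof -
  obtain U where U: "open U" "0 \<in> U" "smooth_on f U" "smooth_on g U"
    using smooth_at_0_2E[OF assms] .
  have "Ck_on k (\<lambda>x. f x + g x) U" for k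
    using U(3,4) unfolding smooth_on_def by (intro Ck_on_add U(1)) blast+
  then show ?thesis using U unfolding smooth_at_0_def smooth_on_def by blast
qed

lemma smooth_at_0_derivative_apply:
  assumes "smooth_at_0 f" "smooth_at_0 \<xi>"
  shows "smooth_at_0 (\<lambda>x. frechet_derivative f (at x) (\<xi> x))"
proof -
  obtain U where U: "open U" "0 \<in> U" "smooth_on f U" "smooth_on \<xi> U"
    using smooth_at_0_2E[OF assms] .
  have "Ck_on k (\<lambda>x. frechet_derivative f (at x) (\<xi> x)) U" for k
    using U(3,4) unfolding smooth_on_def by (intro Ck_on_derivative_apply U(1)) blast+
  then show ?thesis using U unfolding smooth_at_0_def smooth_on_def by blast
qed

lemma smooth_at_0_imp_isCont:
  assumes "smooth_at_0 f"
  shows "isCont f 0"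
proof -
  obtain U where U: "open U" "0 \<in> U" "smooth_on f U"
    using assms by (auto simp: smooth_at_0_def)
  have "Ck_on 0 f U" using U(3) unfolding smooth_on_def by blast
  then show ?thesis using U(1,2) by (simp add: continuous_on_eq_continuous_at)
qed

lemma smooth_at_0_compose:
  fixes f :: "'a::euclidean_space \<Rightarrow> 'b::euclidean_space" and g :: "'b \<Rightarrow> 'c::real_normed_vector"
  assumes "smooth_at_0 f" "f 0 = 0" "smooth_at_0 g"
  shows "smooth_at_0 (\<lambda>x. g (f x))"
proof -
  obtain U V where U: "open U" "0 \<in> U" "smooth_on f U" and V: "open V" "0 \<in> V" "smooth_on g V"
    using assms by (auto simp: smooth_at_0_def)
  have "Ck_on 0 f U" using U unfolding smooth_on_def by blast
  then have "continuous_on U f" by simp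
  then have op: "open (U \<inter> f -` V)" using U V by (intro continuous_open_preimage)
  have "f ` (U \<inter> f -` V) \<subseteq> V" by auto
  moreover have "smooth_on f (U \<inter> f -` V)" by (rule smooth_on_subset[OF U(3)]) blast
  ultimately have "Ck_on k (\<lambda>x. g (f x)) (U \<inter> f -` V)" for k
    using V(3) Ck_on_compose[OF op V(1), of f k g] unfolding smooth_on_def by simp
  then have "smooth_on (\<lambda>x. g (f x)) (U \<inter> f -` V)"
    unfolding smooth_on_def by blast
  then show ?thesis
    unfolding smooth_at_0_def using op U(2) V(2) assms(2)
    by (intro exI[of _ "U \<inter> f -` V"]) simp
qed


section \<open>Germs at the origin\<close>

definition germ_rel :: "('a::euclidean_space \<Rightarrow> 'b::real_normed_vector) \<Rightarrow> ('a \<Rightarrow> 'b) \<Rightarrow> bool" where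
  "germ_rel f g \<longleftrightarrow> smooth_at_0 f \<and> smooth_at_0 g \<and> (\<forall>\<^sub>F x in nhds 0. f x = g x)"

text \<open>
  \<open>('a, 'b) germ\<close> is the space of germs at 0 of smooth maps \<open>'a \<rightarrow> 'b\<close>, with no condition on
  the value at 0. For \<open>'a = real ^ 'n\<close> and \<open>'b = real ^ 'p\<close> it is the module \<open>\<E>\<^sub>n\<^sup>p\<close>, and its
  class instance below is the underlying real vector space. Germs are represented by
  total functions, whose values away from 0 are irrelevant.
\<close>

quotient_type (overloaded) ('a, 'b) germ = "'a::euclidean_space \<Rightarrow> 'b::real_normed_vector" / partial: germ_rel
proof (rule part_equivpI)
  show "\<exists>f::'a \<Rightarrow> 'b. germ_rel f f"
    by (intro exI[of _ "\<lambda>x. 0"]) (simp add: germ_rel_def smooth_at_0_const)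
  show "symp (germ_rel :: ('a \<Rightarrow> 'b) \<Rightarrow> _)"
    by (auto simp: symp_def germ_rel_def elim: eventually_mono)
  show "transp (germ_rel :: ('a \<Rightarrow> 'b) \<Rightarrow> _)"
    by (auto simp: transp_def germ_rel_def elim: eventually_elim2)
qed

lemma abs_germ_eq_iff:
  assumes "smooth_at_0 f" "smooth_at_0 g"
  shows "abs_germ f = abs_germ g \<longleftrightarrow> (\<forall>\<^sub>F x in nhds 0. f x = g x)"
  using assms Quotient_rel[OF Quotient_germ, of f g] by (auto simp: germ_rel_def)

lemma smooth_rep_germ: "smooth_at_0 (rep_germ g)"
  using Quotient_rep_reflp[OF Quotient_germ, of g] by (simp add: germ_rel_def)

lemma abs_rep_germ: "abs_germ (rep_germ g) = g"
  using Quotient_abs_rep[OF Quotient_germ] .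

lemma rep_abs_germ: "smooth_at_0 f \<Longrightarrow> \<forall>\<^sub>F x in nhds 0. rep_germ (abs_germ f) x = f x"
  by (metis abs_germ_eq_iff abs_rep_germ smooth_rep_germ)

lemma germ_cases:
  obtains f where "smooth_at_0 f" "g = abs_germ f"
  by (metis abs_rep_germ smooth_rep_germ)

instantiation germ :: (euclidean_space, real_normed_vector) real_vector
begin

lift_definition zero_germ :: "('a, 'b) germ" is "\<lambda>x. 0"
  by (simp add: germ_rel_def smooth_at_0_const)

lift_definition plus_germ :: "('a, 'b) germ \<Rightarrow> ('a, 'b) germ \<Rightarrow> ('a, 'b) germ"
  is "\<lambda>f g x. f x + g x"
  by (auto simp: germ_rel_def intro: smooth_at_0_add elim: eventually_elim2)

lift_definition scaleR_germ :: "real \<Rightarrow> ('a, 'b) germ \<Rightarrow> ('a, 'b) germ"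
  is "\<lambda>c f x. c *\<^sub>R f x"
  by (auto simp: germ_rel_def intro: smooth_at_0_linear bounded_linear_scaleR_right elim: eventually_mono)

lift_definition uminus_germ :: "('a, 'b) germ \<Rightarrow> ('a, 'b) germ" is "\<lambda>f x. - f x"
  by (auto simp: germ_rel_def intro: smooth_at_0_linear[OF bounded_linear_minus[OF bounded_linear_ident]]
      elim: eventually_mono)

definition minus_germ :: "('a, 'b) germ \<Rightarrow> ('a, 'b) germ \<Rightarrow> ('a, 'b) germ" where
  "minus_germ g h = g + (- h)"

lemma germ_ops:
  fixes f g :: "'a \<Rightarrow> 'b"
  assumes "smooth_at_0 f"
  shows plus_abs_germ: "smooth_at_0 g \<Longrightarrow> abs_germ f + abs_germ g = abs_germ (\<lambda>x. f x + g x)"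
    and scaleR_abs_germ: "c *\<^sub>R abs_germ f = abs_germ (\<lambda>x. c *\<^sub>R f x)"
    and uminus_abs_germ: "- abs_germ f = abs_germ (\<lambda>x. - f x)"
  using assms
  by (auto intro!: plus_germ.abs_eq scaleR_germ.abs_eq uminus_germ.abs_eq simp: germ_rel_def)

instance
proof
  fix f g h :: "('a, 'b) germ" and c d :: real
  obtain f' g' h' where [simp]: "f = abs_germ f'" "g = abs_germ g'" "h = abs_germ h'"
    and [simp]: "smooth_at_0 f'" "smooth_at_0 g'" "smooth_at_0 h'"
    by (metis germ_cases)
  note [simp] = germ_ops smooth_at_0_add smooth_at_0_linear[OF bounded_linear_scaleR_right]
    smooth_at_0_linear[OF bounded_linear_minus[OF bounded_linear_ident]] zero_germ_def smooth_at_0_const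
  show "f + g + h = f + (g + h)" "f + g = g + f" "0 + f = f" "- f + f = 0" "f - g = f + - g"
    "c *\<^sub>R (f + g) = c *\<^sub>R f + c *\<^sub>R g" "(c + d) *\<^sub>R f = c *\<^sub>R f + d *\<^sub>R f"
    "c *\<^sub>R d *\<^sub>R f = (c * d) *\<^sub>R f" "1 *\<^sub>R f = f"
    by (simp_all add: algebra_simps minus_germ_def)
qed

end


section \<open>The extended tangent space\<close>

text \<open>
  For \<open>f\<close> smooth near 0 with \<open>f 0 = 0\<close>, the lemmas \<open>tf_abs_germ\<close> and \<open>\<omega>f_abs_germ\<close> below
  show that the choice of representatives does not matter.
\<close>

definition tf :: "('a::euclidean_space \<Rightarrow> 'b::euclidean_space) \<Rightarrow> ('a, 'a) germ \<Rightarrow> ('a, 'b) germ" where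
  "tf f \<xi> = abs_germ (\<lambda>x. frechet_derivative f (at x) (rep_germ \<xi> x))"

definition \<omega>f :: "('a::euclidean_space \<Rightarrow> 'b::euclidean_space) \<Rightarrow> ('b, 'b) germ \<Rightarrow> ('a, 'b) germ" where
  "\<omega>f f \<eta> = abs_germ (\<lambda>x. rep_germ \<eta> (f x))"

definition TAe :: "('a::euclidean_space \<Rightarrow> 'b::euclidean_space) \<Rightarrow> ('a, 'b) germ set" where
  "TAe f = {tf f \<xi> + \<omega>f f \<eta> | \<xi> \<eta>. True}"

lemma tf_abs_germ:
  assumes "smooth_at_0 f" "smooth_at_0 \<xi>"
  shows "tf f (abs_germ \<xi>) = abs_germ (\<lambda>x. frechet_derivative f (at x) (\<xi> x))"
  unfolding tf_def using assms rep_abs_germ[OF assms(2)]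
  by (subst abs_germ_eq_iff)
     (auto intro: smooth_at_0_derivative_apply smooth_rep_germ elim: eventually_mono)

lemma \<omega>f_abs_germ:
  assumes "smooth_at_0 f" "f 0 = 0" "smooth_at_0 \<eta>"
  shows "\<omega>f f (abs_germ \<eta>) = abs_germ (\<lambda>x. \<eta> (f x))"
proof -
  have "(f \<longlongrightarrow> 0) (nhds 0)"
    using smooth_at_0_imp_isCont[OF assms(1)] assms(2)
    by (metis continuous_within isCont_def tendsto_at_iff_tendsto_nhds)
  then have "\<forall>\<^sub>F x in nhds 0. rep_germ (abs_germ \<eta>) (f x) = \<eta> (f x)"
    using rep_abs_germ[OF assms(3)] by (auto simp: filterlim_iff)
  then show ?thesis
    unfolding \<omega>f_def using assms
    by (subst abs_germ_eq_iff) (auto intro: smooth_at_0_compose smooth_rep_germ)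
qed

lemma tf_linear:
  assumes f: "smooth_at_0 f"
  shows "linear (tf f)"
proof -
  have D: "\<forall>\<^sub>F x in nhds 0. linear (frechet_derivative f (at x))"
  proof -
    obtain U where "open U" "0 \<in> U" "Ck_on (Suc 0) f U"
      using f by (auto simp: smooth_at_0_def smooth_on_def simp del: Ck_on.simps)
    then show ?thesis
      by (auto simp: eventually_nhds simp del: Ck_on.simps
          intro!: exI[of _ U] has_derivative_linear[OF Ck_on_has_derivative])
  qed
  note [simp] = germ_ops tf_abs_germ[OF f] smooth_at_0_add
    smooth_at_0_linear[OF bounded_linear_scaleR_right] smooth_at_0_derivative_apply[OF f]
  show ?thesis
  proof
    fix \<xi> \<zeta> :: "('a, 'a) germ" and c :: real
    obtain \<xi>' \<zeta>' where [simp]: "\<xi> = abs_germ \<xi>'" "\<zeta> = abs_germ \<zeta>'" "smooth_at_0 \<xi>'" "smooth_at_0 \<zeta>'"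
      by (metis germ_cases)
    show "tf f (\<xi> + \<zeta>) = tf f \<xi> + tf f \<zeta>"
      using D by (simp add: abs_germ_eq_iff) (auto simp: linear_add elim: eventually_mono)
    show "tf f (c *\<^sub>R \<xi>) = c *\<^sub>R tf f \<xi>"
      using D by (simp add: abs_germ_eq_iff) (auto simp: linear_scale elim: eventually_mono)
  qed
qed

lemma \<omega>f_linear:
  assumes f: "smooth_at_0 f" "f 0 = 0"
  shows "linear (\<omega>f f)"
proof
  note [simp] = germ_ops \<omega>f_abs_germ[OF f] smooth_at_0_add
    smooth_at_0_linear[OF bounded_linear_scaleR_right] smooth_at_0_compose[OF f]
  fix \<xi> \<zeta> :: "('b, 'b) germ" and c :: real
  obtain \<xi>' \<zeta>' where [simp]: "\<xi> = abs_germ \<xi>'" "\<zeta> = abs_germ \<zeta>'" "smooth_at_0 \<xi>'" "smooth_at_0 \<zeta>'"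
    by (metis germ_cases)
  show "\<omega>f f (\<xi> + \<zeta>) = \<omega>f f \<xi> + \<omega>f f \<zeta>" "\<omega>f f (c *\<^sub>R \<xi>) = c *\<^sub>R \<omega>f f \<xi>"
    by simp_all
qed

lemma subspace_TAe:
  assumes "smooth_at_0 f" "f 0 = 0"
  shows "subspace (TAe f)"
proof -
  have "TAe f = {x + y | x y. x \<in> range (tf f) \<and> y \<in> range (\<omega>f f)}"
    by (auto simp: TAe_def)
  then show ?thesis
    using subspace_sums[OF linear_subspace_image[OF tf_linear[OF assms(1)] subspace_UNIV]
        linear_subspace_image[OF \<omega>f_linear[OF assms] subspace_UNIV]] by simp
qed


section \<open>Dimension of a quotient space\<close>

text \<open>
  The quotient of a real vector space by a subspace \<open>T\<close> has the cosets of \<open>T\<close> as elements and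
  \<open>T\<close> itself as its zero. In \<open>quot_scale\<close>, the added \<open>T\<close> matters only for the scalar 0.
\<close>

definition coset :: "'v::real_vector set \<Rightarrow> 'v \<Rightarrow> 'v set" where
  "coset T v = {v + t | t. t \<in> T}"

definition quot :: "'v::real_vector set \<Rightarrow> 'v set set" where
  "quot T = range (coset T)"

definition quot_add :: "'v::real_vector set \<Rightarrow> 'v set \<Rightarrow> 'v set" where
  "quot_add A B = {a + b | a b. a \<in> A \<and> b \<in> B}"

definition quot_scale :: "'v::real_vector set \<Rightarrow> real \<Rightarrow> 'v set \<Rightarrow> 'v set" where
  "quot_scale T c A = {c *\<^sub>R a + t | a t. a \<in> A \<and> t \<in> T}"

fun quot_lincomb :: "'v::real_vector set \<Rightarrow> (real \<times> 'v set) list \<Rightarrow> 'v set" where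
  "quot_lincomb T [] = T"
| "quot_lincomb T ((c, A) # ps) = quot_add (quot_scale T c A) (quot_lincomb T ps)"

definition quot_independent :: "'v::real_vector set \<Rightarrow> 'v set list \<Rightarrow> bool" where
  "quot_independent T As \<longleftrightarrow> set As \<subseteq> quot T \<and>
     (\<forall>cs. length cs = length As \<longrightarrow> quot_lincomb T (zip cs As) = T \<longrightarrow> set cs \<subseteq> {0})"

text \<open>The dimension of the quotient, as the supremum of the lengths of its independent families.\<close>

definition codim :: "'v::real_vector set \<Rightarrow> enat" where
  "codim T = Sup {enat (length As) | As. quot_independent T As}"

lemma coset_eq_iff: "subspace T \<Longrightarrow> coset T u = coset T v \<longleftrightarrow> u - v \<in> T"
proof
  assume T: "subspace T" and "coset T u = coset T v"
  then have "u \<in> coset T v" using subspace_0[OF T] by (force simp: coset_def)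
  then show "u - v \<in> T" by (auto simp: coset_def)
next
  assume T: "subspace T" and uv: "u - v \<in> T"
  have "u + t = v + ((u - v) + t)" "v + t = u + (t - (u - v))" for t by simp_all
  then show "coset T u = coset T v"
    unfolding coset_def using subspace_add[OF T uv] subspace_diff[OF T _ uv] by blast
qed

lemma coset_0: "coset T 0 = T"
  by (auto simp: coset_def)

lemma quot_add_coset:
  assumes "subspace T"
  shows "quot_add (coset T u) (coset T v) = coset T (u + v)"
proof
  show "quot_add (coset T u) (coset T v) \<subseteq> coset T (u + v)"
    using subspace_add[OF assms] by (force simp: quot_add_def coset_def algebra_simps)
  have "u + v + t = (u + t) + (v + 0)" for t by simp
  then show "coset T (u + v) \<subseteq> quot_add (coset T u) (coset T v)"
    unfolding quot_add_def coset_def using subspace_0[OF assms] by blast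
qed

lemma quot_scale_coset:
  assumes "subspace T"
  shows "quot_scale T c (coset T v) = coset T (c *\<^sub>R v)"
proof
  show "quot_scale T c (coset T v) \<subseteq> coset T (c *\<^sub>R v)"
    using subspace_add[OF assms subspace_scale[OF assms]]
    by (force simp: quot_scale_def coset_def algebra_simps)
  have "c *\<^sub>R v + t = c *\<^sub>R (v + 0) + t" for t by simp
  then show "coset T (c *\<^sub>R v) \<subseteq> quot_scale T c (coset T v)"
    using subspace_0[OF assms] by (force simp: quot_scale_def coset_def)
qed

lemma quot_lincomb_coset:
  assumes "subspace T" "length cs = length vs"
  shows "quot_lincomb T (zip cs (map (coset T) vs)) = coset T (\<Sum>i<length vs. (cs ! i) *\<^sub>R (vs ! i))"
  using assms(2)
proof (induction cs vs rule: list_induct2)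
  case Nil
  then show ?case by (simp add: coset_0)
next
  case (Cons c cs v vs)
  then show ?case
    by (simp add: quot_add_coset quot_scale_coset assms(1) sum.lessThan_Suc_shift del: sum.lessThan_Suc)
qed

lemma quot_independent_map_coset:
  assumes "subspace T"
  shows "quot_independent T (map (coset T) vs) \<longleftrightarrow>
    (\<forall>cs. length cs = length vs \<longrightarrow> (\<Sum>i<length vs. (cs ! i) *\<^sub>R (vs ! i)) \<in> T \<longrightarrow> set cs \<subseteq> {0})"
proof -
  have "coset T w = T \<longleftrightarrow> w \<in> T" for w
    using coset_eq_iff[OF assms, of w 0] by (simp add: coset_0)
  then show ?thesis
    by (auto simp: quot_independent_def quot_def quot_lincomb_coset[OF assms])
qed

definition Ae_codim :: "('a::euclidean_space \<Rightarrow> 'b::euclidean_space) \<Rightarrow> enat" where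
  "Ae_codim f = codim (TAe f)"

end

theory Submission
  imports Defs "HOL-Computational_Algebra.Polynomial"
begin

text \<open>
  In complex notation, \<open>f\<close> is \<open>r e\<^sup>i\<^sup>s + z\<^sup>2\<close>. Its singular set is the \<open>s\<close>-axis, which \<open>f\<close> collapses
  to the origin. On that axis, \<open>tf \<xi>\<close> is a multiple of \<open>(cos s, sin s)\<close> and \<open>\<omega>f \<eta>\<close> is the constant
  \<open>\<eta> 0\<close>, so pairing an element of the tangent space with \<open>(- sin s, cos s)\<close> leaves a combination
  of \<open>sin s\<close> and \<open>cos s\<close>. The germs \<open>s\<^sup>k (- sin s, cos s)\<close> pair to \<open>s\<^sup>k\<close>, and no nonzero polynomial
  is such a combination near 0, so they are independent modulo the tangent space.
\<close>

text \<open>The two claims go through one induction because the derivative of each function is a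
  multiple of the other.\<close>

lemma Ck_on_sin_cos:
  "Ck_on k (sin :: real \<Rightarrow> real) UNIV \<and> Ck_on k (cos :: real \<Rightarrow> real) UNIV"
proof (induction k)
  case 0
  then show ?case by (auto intro!: continuous_intros)
next
  case (Suc k)
  have "Ck_on (Suc k) (sin :: real \<Rightarrow> real) UNIV"
  proof (rule Ck_on_SucI)
    show "(sin has_derivative (\<lambda>v. v * cos x)) (at x)" for x :: real
      by (auto intro!: derivative_eq_intros)
    show "Ck_on k (\<lambda>x::real. v * cos x) UNIV" for v
      using Suc by (intro Ck_on_bounded_linear[OF bounded_linear_mult_right]) auto
  qed simp
  moreover have "Ck_on (Suc k) (cos :: real \<Rightarrow> real) UNIV"
  proof (rule Ck_on_SucI)
    show "(cos has_derivative (\<lambda>v. (- v) * sin x)) (at x)" for x :: real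
      by (auto intro!: derivative_eq_intros)
    show "Ck_on k (\<lambda>x::real. (- v) * sin x) UNIV" for v
      using Suc by (intro Ck_on_bounded_linear[OF bounded_linear_mult_right]) auto
  qed simp
  ultimately show ?case by blast
qed

lemma Ck_on_ident: "Ck_on k (\<lambda>x. x) UNIV"
proof (cases k)
  case (Suc j)
  show ?thesis
    unfolding Suc by (rule Ck_on_SucI[OF open_UNIV has_derivative_ident Ck_on_const[OF open_UNIV]])
qed simp

lemma smooth_at_0_bilinear:
  assumes "bounded_bilinear B" "smooth_at_0 f" "smooth_at_0 g"
  shows "smooth_at_0 (\<lambda>x. B (f x) (g x))"
proof -
  obtain U where U: "open U" "0 \<in> U" "smooth_on f U" "smooth_on g U"
    using smooth_at_0_2E[OF assms(2,3)] .
  have "Ck_on k (\<lambda>x. B (f x) (g x)) U" for k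
    using U(3,4) Ck_on_bilinear[OF assms(1) U(1), of k f g] unfolding smooth_on_def by simp
  then show ?thesis using U unfolding smooth_at_0_def smooth_on_def by blast
qed

lemmas smooth_at_0_mult = smooth_at_0_bilinear[OF bounded_bilinear_mult]
lemmas smooth_at_0_scaleR = smooth_at_0_bilinear[OF bounded_bilinear_scaleR]

lemma smooth_at_0_bounded_linear:
  assumes "bounded_linear L"
  shows "smooth_at_0 (L :: 'a::euclidean_space \<Rightarrow> 'b::real_normed_vector)"
proof -
  have "smooth_at_0 (\<lambda>x::'a. x)"
    unfolding smooth_at_0_def smooth_on_def by (intro exI[of _ UNIV]) (simp add: Ck_on_ident)
  then show ?thesis using smooth_at_0_linear[OF assms, of "\<lambda>x. x"] by simp
qed

lemmas smooth_at_0_nth = smooth_at_0_bounded_linear[OF bounded_linear_vec_nth]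

lemma smooth_at_0_minus: "smooth_at_0 f \<Longrightarrow> smooth_at_0 (\<lambda>x. - f x)"
  by (rule smooth_at_0_linear[OF bounded_linear_minus[OF bounded_linear_ident]])

lemma smooth_at_0_power:
  fixes f :: "'a::euclidean_space \<Rightarrow> real"
  assumes "smooth_at_0 f"
  shows "smooth_at_0 (\<lambda>x. f x ^ k)"
  by (induction k) (auto intro: smooth_at_0_const smooth_at_0_mult assms)

lemma smooth_at_0_sin_nth: "smooth_at_0 (\<lambda>x::real^'n. sin (x $ i))"
  and smooth_at_0_cos_nth: "smooth_at_0 (\<lambda>x::real^'n. cos (x $ i))"
proof -
  have "smooth_at_0 (sin :: real \<Rightarrow> real)" "smooth_at_0 (cos :: real \<Rightarrow> real)"
    unfolding smooth_at_0_def smooth_on_def by (intro exI[of _ UNIV]; simp add: Ck_on_sin_cos)+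
  then show "smooth_at_0 (\<lambda>x::real^'n. sin (x $ i))" "smooth_at_0 (\<lambda>x::real^'n. cos (x $ i))"
    using smooth_at_0_compose[OF smooth_at_0_nth[of i] zero_index] by blast+
qed

text \<open>Smoothness of the partial sum is part of the induction claim: adding germs through their
  representatives requires both to be smooth.\<close>

lemma sum_scaleR_abs_germ:
  fixes g :: "nat \<Rightarrow> 'a::euclidean_space \<Rightarrow> 'b::real_normed_vector"
  assumes "\<And>i. smooth_at_0 (g i)"
  shows "smooth_at_0 (\<lambda>x. \<Sum>i<n. c i *\<^sub>R g i x) \<and>
    (\<Sum>i<n. c i *\<^sub>R abs_germ (g i)) = abs_germ (\<lambda>x. \<Sum>i<n. c i *\<^sub>R g i x)"
proof (induction n)
  case 0
  then show ?case by (simp add: zero_germ_def smooth_at_0_const)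
next
  case (Suc n)
  then show ?case
    using assms by (simp add: germ_ops smooth_at_0_add smooth_at_0_linear[OF bounded_linear_scaleR_right])
qed

lemma infinite_real_nhds:
  fixes a :: real
  assumes "\<forall>\<^sub>F s in nhds a. P s"
  shows "infinite {s. P s}"
proof -
  obtain e where "e > 0" "\<And>s. dist s a < e \<Longrightarrow> P s"
    using assms by (auto simp: eventually_nhds_metric)
  then have "{a<..<a + e} \<subseteq> {s. P s}" by (auto simp: dist_real_def)
  then show ?thesis using \<open>e > 0\<close> by (meson infinite_Ioo finite_subset less_add_same_cancel1)
qed

text \<open>The right-hand side solves \<open>h'' = - h\<close>, so \<open>p'' + p\<close> vanishes
  near 0, has infinitely many roots and is the zero polynomial. Differentiation lowers the degree,
  which leaves only \<open>p = 0\<close>.\<close>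

lemma poly_eq_sin_cos_near_0:
  fixes p :: "real poly"
  assumes "\<forall>\<^sub>F s in nhds 0. poly p s = a * sin s + b * cos s"
  shows "p = 0"
proof -
  have D: "\<forall>\<^sub>F s in nhds 0. poly (pderiv p) s = h' s"
    if "\<forall>\<^sub>F s in nhds 0. poly p s = h s" "\<And>s. (h has_real_derivative h' s) (at s)"
    for p :: "real poly" and h h'
  proof -
    \<comment> \<open>Differentiating at \<open>t\<close> needs the equality on a whole
      neighbourhood of \<open>t\<close>, not just at \<open>t\<close>.\<close>
    have "\<forall>\<^sub>F t in nhds 0. \<forall>\<^sub>F s in nhds t. poly p s = h s"
      using that(1) by (simp add: eventually_eventually)
    then show ?thesis
    proof eventually_elim
      case (elim t)
      then show ?case
        using that(2) DERIV_cong_ev[OF refl elim refl] poly_DERIV DERIV_unique by blast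
    qed
  qed
  have "\<forall>\<^sub>F s in nhds 0. poly (pderiv p) s = a * cos s - b * sin s"
    by (rule D[OF assms]) (auto intro!: derivative_eq_intros)
  then have "\<forall>\<^sub>F s in nhds 0. poly (pderiv (pderiv p)) s = - a * sin s - b * cos s"
    by (rule D) (auto intro!: derivative_eq_intros)
  with assms have "\<forall>\<^sub>F s in nhds 0. poly (pderiv (pderiv p) + p) s = 0"
    by eventually_elim simp
  then have "pderiv (pderiv p) + p = 0"
    using infinite_real_nhds poly_roots_finite by blast
  then have eq: "pderiv (pderiv p) = - p" by (simp add: eq_neg_iff_add_eq_0)
  \<comment> \<open>Subtraction on the naturals truncates, so this equation holds only in degree
    0.\<close>
  then have "degree p = degree p - 2"
    by (metis degree_minus degree_pderiv diff_diff_left one_add_one)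
  then have "degree p = 0" by simp
  then have "pderiv p = 0" using pderiv_eq_0_iff by blast
  then show "p = 0" using eq by simp
qed

theorem propositionA1:
  fixes f :: "real ^ 4 \<Rightarrow> real ^ 2"
  assumes "\<And>r s x y. f (vector [r, s, x, y]) =
    vector [r * cos s + x\<^sup>2 - y\<^sup>2, r * sin s + 2 * x * y]"
  shows "Ae_codim f = \<infinity>"
proof -
  \<comment> \<open>A closed form in the coordinates of \<open>x\<close>, built only from operations
    that the smoothness rules cover; hence \<open>+ -\<close> for the difference.\<close>
  have f: "f = (\<lambda>x. (x $ 1 * cos (x $ 2) + (x $ 3)\<^sup>2 + - ((x $ 4)\<^sup>2)) *\<^sub>R axis 1 1
      + (x $ 1 * sin (x $ 2) + 2 * (x $ 3 * x $ 4)) *\<^sub>R axis 2 1)"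
  proof
    fix x :: "real ^ 4"
    have "x = vector [x $ 1, x $ 2, x $ 3, x $ 4]"
      by (simp add: vec_eq_iff forall_4 vector_def)
    then have "f x = f (vector [x $ 1, x $ 2, x $ 3, x $ 4])" by simp
    then show "f x = (x $ 1 * cos (x $ 2) + (x $ 3)\<^sup>2 + - ((x $ 4)\<^sup>2)) *\<^sub>R axis 1 1
      + (x $ 1 * sin (x $ 2) + 2 * (x $ 3 * x $ 4)) *\<^sub>R axis 2 1"
      by (simp add: assms vec_eq_iff forall_2 axis_def)
  qed
  have smooth_f: "smooth_at_0 f"
    unfolding f
    by (intro smooth_at_0_add smooth_at_0_scaleR smooth_at_0_mult smooth_at_0_minus smooth_at_0_power
        smooth_at_0_const smooth_at_0_nth smooth_at_0_sin_nth smooth_at_0_cos_nth)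
  have f_axis: "f (axis 2 s) = 0" for s
    by (simp add: f axis_def)
  have f_0: "f 0 = 0"
    by (simp add: f)
  \<comment> \<open>On the axis \<open>r = x = y = 0\<close>, so the partial derivatives in
    \<open>s\<close>, \<open>x\<close> and \<open>y\<close> vanish and only the one in
    \<open>r\<close> survives.\<close>
  have deriv_f: "(f has_derivative (\<lambda>v. (v $ 1) *\<^sub>R (cos s *\<^sub>R axis 1 1 + sin s *\<^sub>R axis 2 1)))
    (at (axis 2 s))" for s
  proof -
    have [simp]: "(axis 2 s :: real ^ 4) $ 1 = 0" "(axis 2 s :: real ^ 4) $ 2 = s"
      "(axis 2 s :: real ^ 4) $ 3 = 0" "(axis 2 s :: real ^ 4) $ 4 = 0"
      by (simp_all add: axis_def)
    note [derivative_intros] = bounded_linear.has_derivative[OF bounded_linear_vec_nth]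
    show ?thesis
      unfolding f by (rule derivative_eq_intros refl | simp add: algebra_simps)+
  qed

  \<comment> \<open>\<open>u s\<close> is the unit normal to the image of the derivative of
    \<open>f\<close> at \<open>axis 2 s\<close>.\<close>
  define u :: "real \<Rightarrow> real ^ 2"
    where "u s = (- sin s) *\<^sub>R axis 1 1 + cos s *\<^sub>R axis 2 1" for s
  define g where "g k x = (x $ 2) ^ k *\<^sub>R u (x $ 2)" for k and x :: "real ^ 4"
  have smooth_g: "smooth_at_0 (g k)" for k
    unfolding g_def u_def
    by (intro smooth_at_0_add smooth_at_0_scaleR smooth_at_0_minus smooth_at_0_power
        smooth_at_0_const smooth_at_0_nth smooth_at_0_sin_nth smooth_at_0_cos_nth)

  have indep: "\<forall>i<n. c i = 0"
    if mem: "(\<Sum>i<n. c i *\<^sub>R abs_germ (g i)) \<in> TAe f" for c n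
  proof -
    \<comment> \<open>On the axis the combination of the \<open>g i\<close> is
      \<open>poly p s *\<^sub>R u s\<close>, so it suffices to show \<open>p = 0\<close>.\<close>
    define p where "p = (\<Sum>i<n. monom (c i) i)"
    let ?g = "\<lambda>x. \<Sum>i<n. c i *\<^sub>R g i x"
    have sum_g: "smooth_at_0 ?g" "(\<Sum>i<n. c i *\<^sub>R abs_germ (g i)) = abs_germ ?g"
      using sum_scaleR_abs_germ[where g = g and c = c and n = n] smooth_g by auto
    obtain \<xi> \<eta> where "abs_germ ?g = tf f \<xi> + \<omega>f f \<eta>"
      using mem unfolding sum_g(2) TAe_def by auto
    moreover obtain \<xi>' \<eta>' where [simp]: "\<xi> = abs_germ \<xi>'" "\<eta> = abs_germ \<eta>'"
      and sm: "smooth_at_0 \<xi>'" "smooth_at_0 \<eta>'"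
      by (metis germ_cases)
    moreover note sm' = smooth_at_0_derivative_apply[OF smooth_f sm(1)]
      smooth_at_0_compose[OF smooth_f f_0 sm(2)]
    ultimately have "abs_germ ?g =
        abs_germ (\<lambda>x. frechet_derivative f (at x) (\<xi>' x) + \<eta>' (f x))"
      by (simp add: tf_abs_germ[OF smooth_f] \<omega>f_abs_germ[OF smooth_f f_0] plus_abs_germ)
    then have ev: "\<forall>\<^sub>F x in nhds 0. ?g x = frechet_derivative f (at x) (\<xi>' x) + \<eta>' (f x)"
      using sum_g
      by (subst (asm) abs_germ_eq_iff) (auto intro: smooth_at_0_add[OF sm'])
    \<comment> \<open>The axis passes continuously through the origin, so the equality
      \<open>ev\<close> near 0 in the source restricts to all small \<open>s\<close>.\<close>
    have "((\<lambda>s. axis 2 s :: real ^ 4) \<longlongrightarrow> axis 2 0) (nhds 0)"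
    proof (rule vec_tendstoI)
      show "((\<lambda>s. (axis 2 s :: real ^ 4) $ i) \<longlongrightarrow> axis 2 0 $ i) (nhds 0)" for i
        by (cases "i = 2") (simp_all add: axis_def filterlim_ident)
    qed
    then have "filterlim (\<lambda>s. axis 2 s :: real ^ 4) (nhds 0) (nhds 0)"
      by (simp add: axis_def zero_vec_def)
    then have "\<forall>\<^sub>F s in nhds 0. ?g (axis 2 s) =
        frechet_derivative f (at (axis 2 s)) (\<xi>' (axis 2 s)) + \<eta>' (f (axis 2 s))"
      using ev by (auto simp: filterlim_iff)
    then have "\<forall>\<^sub>F s in nhds 0. poly p s = (- (\<eta>' 0 $ 1)) * sin s + \<eta>' 0 $ 2 * cos s"
    proof eventually_elim
      case (elim s)
      let ?v = "\<xi>' (axis 2 s) $ 1"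
      have "?g (axis 2 s) = poly p s *\<^sub>R u s"
        by (simp add: p_def g_def poly_sum poly_monom scaleR_sum_left)
      moreover have "frechet_derivative f (at (axis 2 s)) =
          (\<lambda>v. (v $ 1) *\<^sub>R (cos s *\<^sub>R axis 1 1 + sin s *\<^sub>R axis 2 1))"
        by (rule frechet_derivative_at[OF deriv_f, symmetric])
      ultimately have "poly p s *\<^sub>R u s
          = ?v *\<^sub>R (cos s *\<^sub>R axis 1 1 + sin s *\<^sub>R axis 2 1) + \<eta>' 0"
        using elim by (simp add: f_axis)
      then have 1: "- (poly p s * sin s) = ?v * cos s + \<eta>' 0 $ 1"
        and 2: "poly p s * cos s = ?v * sin s + \<eta>' 0 $ 2"
        by (simp_all add: vec_eq_iff forall_2 u_def axis_def)
      \<comment> \<open>This is the pairing with \<open>u s\<close>: equation \<open>1\<close> times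
        \<open>- sin s\<close> plus equation \<open>2\<close> times \<open>cos s\<close> cancels the
        unknown \<open>?v\<close>.\<close>
      have "poly p s = poly p s * ((sin s)\<^sup>2 + (cos s)\<^sup>2)" by simp
      also have "\<dots> = (- sin s) * (- (poly p s * sin s)) + cos s * (poly p s * cos s)"
        unfolding power2_eq_square by (simp only: algebra_simps minus_mult_minus)
      also have "\<dots> = (- (\<eta>' 0 $ 1)) * sin s + \<eta>' 0 $ 2 * cos s"
        unfolding 1 2 by (simp add: algebra_simps)
      finally show ?case .
    qed
    then have "p = 0" by (rule poly_eq_sin_cos_near_0)
    moreover have "coeff p i = c i" if "i < n" for i
      using that by (simp add: p_def coeff_sum)
    ultimately show ?thesis by simp
  qed

  \<comment> \<open>The cosets of the first \<open>n\<close> germs \<open>g k\<close> form an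
    independent family of length \<open>n\<close>, which bounds the supremum in \<open>codim\<close>
    from below.\<close>
  have "enat n \<le> Ae_codim f" for n
  proof -
    let ?vs = "map (\<lambda>k. abs_germ (g k)) [0..<n]"
    have "quot_independent (TAe f) (map (coset (TAe f)) ?vs)"
      unfolding quot_independent_map_coset[OF subspace_TAe[OF smooth_f f_0]]
    proof (intro allI impI)
      fix cs :: "real list"
      assume len: "length cs = length ?vs"
        and "(\<Sum>i<length ?vs. cs ! i *\<^sub>R ?vs ! i) \<in> TAe f"
      then have "\<forall>i<n. cs ! i = 0" by (intro indep) simp
      then show "set cs \<subseteq> {0}" using len by (auto simp: in_set_conv_nth)
    qed
    then have "enat (length (map (coset (TAe f)) ?vs)) \<le> codim (TAe f)"
      unfolding codim_def by (intro Sup_upper) blast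
    then show ?thesis by (simp add: Ae_codim_def)
  qed
  then show ?thesis
    \<comment> \<open>A finite value \<open>enat m\<close> would contradict the bound for
      \<open>n = Suc m\<close>.\<close>
    by (metis enat_ord_simps(1) not_enat_eq not_less_eq_eq order_refl)
qed

end
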